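(* Let $b>1$ be an integer and let $M$ be a DFA with input alphabet $\Sigma_b=\{0,\dots,b-1,.\}$ which is minimal and well-formed. Then $M$ is well-ordered if and only if for each relevant postradix state $q$ of $M$, the subgraph $G_q$ of the transition graph of $M$ consisting of the relevant states reachable from $q$ is a rooted saguaro with root $q$, equipped (via its transition labels) with a proper $b$-labeling.
   Context: A deterministic finite automaton (DFA) is a tuple $M=(Q,\Sigma,\delta,q_0,F)$ with $Q$ a finite set of states, $\Sigma$ the input alphabet, $\delta:Q\times\Sigma\to Q$, $q_0\in Q$ the initial state, $F\subseteq Q$ the accepting (final) states. Extend $\delta$ to $\delta^*:Q\times\Sigma^*\to Q$ by $\delta^*(q,\emptyset)=q$, $\delta^*(q,xa)=\delta(\delta^*(q,x),a)$. The language accepted by $M$ is $\{x\in\Sigma^*:\delta^*(q_0,x)\in F\}$. The transition graph of $M$ is the edge-labeled directed graph on vertex set $Q$ (loops allowed; parallel edges with different labels count as distinct edges) with an edge from $q$ to $q'$ labeled $s$ whenever $\delta(q,s)=q'$. A valid base $b$ expansion is a string $s_1\cdots s_n\in\Sigma_b^*$ with $s_1\neq0$, $s_n\ne0$ and exactly one $s_k$ equal to the radix point "."; its value is $\sum_{i=1}^{k-1}s_ib^{k-1-i}+\sum_{i=k+1}^ns_ib^{k-i}$. Values of valid expansions are exactly the elements of $S_b=\{m/b^n:m,n\in\mathbb{Z}_{\geq0}\}$, each having a unique valid expansion. A state $q$ is reachable from a state $q_1$ if $\delta^*(q_1,s)=q$ for some $s\in\Sigma_b^*$ (possibly empty). $M$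 is minimal if every state is reachable from $q_0$. A state $q$ is relevant if some final state is reachable from $q$. A state $q$ is postradix if there is a valid base $b$ expansion $s_1\cdots s_n$ with $s_k$ the radix point such that, putting $q_i=\delta(q_{i-1},s_i)$ for $i=1,\dots,n$ (starting from the initial state $q_0$), one has $q=q_i$ for some $i\geq k$. $M$ is well-formed (resp. well-ordered) if the language it accepts consists of the valid base $b$ expansions of the elements of an arbitrary (resp. a well-ordered) subset of $S_b$; a set of rationals is well-ordered if it contains no infinite strictly decreasing sequence. A directed graph $G=(V,E)$ with distinguished vertex $v$ is a rooted saguaro with root $v$ if (a) each vertex of $G$ lies on at most one minimal (directed) cycle, and (b) there exist directed paths from $v$ to each vertex of $G$. A minimal cycle of a rooted saguaro is called a lobe. A proper $b$-labeling of a rooted saguaro $G$ is a function $\ell:E\to\{0,\dots,b-1\}$ such that (a) distinct edges with the same initial vertex have different labels; and (b) if two edges have the same initial vertex, the first lying on a lobe and the second not lying on a lobe, then the label of the first is strictly greater than the label of the second. *)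

theory Defs
  imports Complex_Main "Graph_Theory.Digraph_Component"
begin

section \<open>Deterministic finite automata\<close>

record ('q, 'a) dfa =
  states :: "'q set"
  alphabet :: "'a set"
  trans :: "'q \<Rightarrow> 'a \<Rightarrow> 'q"
  start :: 'q
  finals :: "'q set"

text \<open>The values of \<^const>\<open>trans\<close> outside \<open>states M \<times> alphabet M\<close> are irrelevant.\<close>

definition is_dfa :: "('q, 'a) dfa \<Rightarrow> bool" where
  "is_dfa M \<longleftrightarrow> finite (states M) \<and> finite (alphabet M) \<and>
     (\<forall>q\<in>states M. \<forall>a\<in>alphabet M. trans M q a \<in> states M) \<and>
     start M \<in> states M \<and> finals M \<subseteq> states M"

definition trans_star :: "('q, 'a) dfa \<Rightarrow> 'q \<Rightarrow> 'a list \<Rightarrow> 'q" where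
  "trans_star M q w = foldl (trans M) q w"

definition language :: "('q, 'a) dfa \<Rightarrow> 'a list set" where
  "language M = {w \<in> lists (alphabet M). trans_star M (start M) w \<in> finals M}"

definition reachable_from :: "('q, 'a) dfa \<Rightarrow> 'q \<Rightarrow> 'q \<Rightarrow> bool" where
  "reachable_from M q1 q \<longleftrightarrow> (\<exists>w\<in>lists (alphabet M). trans_star M q1 w = q)"

text \<open>In this development a DFA is minimal if it has no unreachable states; states with the same
  residual language are allowed.\<close>

definition minimal_dfa :: "('q, 'a) dfa \<Rightarrow> bool" where
  "minimal_dfa M \<longleftrightarrow> (\<forall>q\<in>states M. reachable_from M (start M) q)"

definition relevant :: "('q, 'a) dfa \<Rightarrow> 'q \<Rightarrow> bool" where
  "relevant M q \<longleftrightarrow> (\<exists>f\<in>finals M. reachable_from M q f)"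

text \<open>An edge is the triple of its source, its label and its target, so that edges which are
  parallel but carry different labels are distinct.\<close>

definition transition_graph :: "('q, 'a) dfa \<Rightarrow> ('q, 'q \<times> 'a \<times> 'q) pre_digraph" where
  "transition_graph M =
     \<lparr> verts = states M,
       arcs = {(q, s, q'). q \<in> states M \<and> s \<in> alphabet M \<and> trans M q s = q'},
       tail = (\<lambda>(q, s, q'). q),
       head = (\<lambda>(q, s, q'). q') \<rparr>"

definition edge_label :: "'q \<times> 'a \<times> 'q \<Rightarrow> 'a" where
  "edge_label = (\<lambda>(q, s, q'). s)"

definition relevant_subgraph :: "('q, 'a) dfa \<Rightarrow> 'q \<Rightarrow> ('q, 'q \<times> 'a \<times> 'q) pre_digraph" where
  "relevant_subgraph M q =
     transition_graph M \<restriction> {q' \<in> states M. relevant M q' \<and> reachable_from M q q'}"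


section \<open>Base \<open>b\<close> expansions\<close>

datatype symbol = Digit nat | Radix

definition Sigma_base :: "nat \<Rightarrow> symbol set" where
  "Sigma_base b = insert Radix (Digit ` {..<b})"

primrec digit_val :: "symbol \<Rightarrow> nat" where
  "digit_val (Digit d) = d"
| "digit_val Radix = 0"

definition valid_expansion :: "nat \<Rightarrow> symbol list \<Rightarrow> bool" where
  "valid_expansion b w \<longleftrightarrow> w \<in> lists (Sigma_base b) \<and> w \<noteq> [] \<and>
     hd w \<noteq> Digit 0 \<and> last w \<noteq> Digit 0 \<and> (\<exists>!k. k < length w \<and> w ! k = Radix)"

text \<open>List positions count from 0: if the radix point of \<open>s\<^sub>1\<dots>s\<^sub>n\<close> is \<open>s\<^sub>k\<close>, its \<open>radix_pos\<close>
  is \<open>k - 1\<close>. The exponents below depend only on the distance to the radix point.\<close>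

definition radix_pos :: "symbol list \<Rightarrow> nat" where
  "radix_pos w = (THE k. k < length w \<and> w ! k = Radix)"

definition expansion_value :: "nat \<Rightarrow> symbol list \<Rightarrow> rat" where
  "expansion_value b w =
     (\<Sum>i<radix_pos w. of_nat (digit_val (w ! i)) * of_nat b ^ (radix_pos w - 1 - i)) +
     (\<Sum>i\<in>{radix_pos w<..<length w}. of_nat (digit_val (w ! i)) / of_nat b ^ (i - radix_pos w))"

definition S_base :: "nat \<Rightarrow> rat set" where
  "S_base b = {of_nat m / of_nat b ^ n | m n. True}"

definition expansions_of :: "nat \<Rightarrow> rat set \<Rightarrow> symbol list set" where
  "expansions_of b S = {w. valid_expansion b w \<and> expansion_value b w \<in> S}"

definition well_ordered_set :: "rat set \<Rightarrow> bool" where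
  "well_ordered_set S \<longleftrightarrow> \<not> (\<exists>f :: nat \<Rightarrow> rat. (\<forall>n. f n \<in> S) \<and> (\<forall>n. f (Suc n) < f n))"

definition well_formed :: "nat \<Rightarrow> ('q, symbol) dfa \<Rightarrow> bool" where
  "well_formed b M \<longleftrightarrow> (\<exists>S\<subseteq>S_base b. language M = expansions_of b S)"

definition well_ordered :: "nat \<Rightarrow> ('q, symbol) dfa \<Rightarrow> bool" where
  "well_ordered b M \<longleftrightarrow>
     (\<exists>S\<subseteq>S_base b. well_ordered_set S \<and> language M = expansions_of b S)"

text \<open>The state \<open>q\<^sub>i\<close> is reached after reading the first \<open>i\<close> symbols, and the radix point is among
  these iff \<open>radix_pos w < i\<close>. The expansion need not be accepted.\<close>

definition postradix :: "nat \<Rightarrow> ('q, symbol) dfa \<Rightarrow> 'q \<Rightarrow> bool" where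
  "postradix b M q \<longleftrightarrow>
     (\<exists>w i. valid_expansion b w \<and> radix_pos w < i \<and> i \<le> length w \<and>
            q = trans_star M (start M) (take i w))"


section \<open>Rooted saguaros\<close>

text \<open>The minimal cycles are those of \<^const>\<open>pre_digraph.cycle\<close>: closed walks of positive length
  (loops included) without repeated vertices. They are lists of edges starting at an arbitrary vertex
  of the cycle, so two such lists are the same cycle iff they have the same set of edges. Every vertex
  of a cycle is the tail of one of its edges.\<close>

definition minimal_cycle :: "('v, 'e) pre_digraph \<Rightarrow> 'e set \<Rightarrow> bool" where
  "minimal_cycle G C \<longleftrightarrow> (\<exists>p. pre_digraph.cycle G p \<and> C = set p)"

definition rooted_saguaro :: "('v, 'e) pre_digraph \<Rightarrow> 'v \<Rightarrow> bool" where
  "rooted_saguaro G v \<longleftrightarrow> wf_digraph G \<and> v \<in> verts G \<and>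
     (\<forall>u\<in>verts G. \<forall>C C'. minimal_cycle G C \<and> u \<in> tail G ` C \<and>
        minimal_cycle G C' \<and> u \<in> tail G ` C' \<longrightarrow> C = C') \<and>
     (\<forall>u\<in>verts G. v \<rightarrow>\<^sup>*\<^bsub>G\<^esub> u)"

definition on_lobe :: "('v, 'e) pre_digraph \<Rightarrow> 'e \<Rightarrow> bool" where
  "on_lobe G e \<longleftrightarrow> (\<exists>C. minimal_cycle G C \<and> e \<in> C)"

definition proper_labeling :: "nat \<Rightarrow> ('v, 'e) pre_digraph \<Rightarrow> ('e \<Rightarrow> nat) \<Rightarrow> bool" where
  "proper_labeling b G l \<longleftrightarrow>
     (\<forall>e\<in>arcs G. l e < b) \<and>
     (\<forall>e\<in>arcs G. \<forall>e'\<in>arcs G. e \<noteq> e' \<and> tail G e = tail G e' \<longrightarrow> l e \<noteq> l e') \<and>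
     (\<forall>e\<in>arcs G. \<forall>e'\<in>arcs G. tail G e = tail G e' \<and> on_lobe G e \<and> \<not> on_lobe G e' \<longrightarrow> l e > l e')"

text \<open>The transition labels are symbols, not numbers; that they form a proper labeling includes that
  none of them is the radix point.\<close>

definition properly_labeled_by_transitions ::
    "nat \<Rightarrow> ('q, 'q \<times> symbol \<times> 'q) pre_digraph \<Rightarrow> bool" where
  "properly_labeled_by_transitions b G \<longleftrightarrow>
     (\<exists>l. (\<forall>e\<in>arcs G. edge_label e = Digit (l e)) \<and> proper_labeling b G l)"

end

theory Submission
  imports Defs "HOL-Library.Infinite_Set"
begin

text \<open>Both sides are equivalent to the following condition on each relevant postradix state: if
  reading the digit \<open>d\<close> there leads back to the state, then no larger digit leads to a relevant state.
  If a larger digit does, prepending the loop to an accepted continuation through that digit decreases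
  its value, so iterating the loop gives an infinite descent. Conversely, an infinite descent has a
  subsequence with constant integer part, whose fractional parts are words read
  from one postradix state; the digits stabilize one after the other, eventually along a lobe, and
  since no larger digit branches off a lobe, every word of the sequence would have to follow the lobe
  forever.\<close>

section \<open>Minimal cycles\<close>

text \<open>Cutting a cycle at \<open>e\<close> leaves a walk from its head back to its tail.
  Conversely such a walk shortens to a simple path, which \<open>e\<close> closes to a minimal
  cycle. Lobes thereby become a matter of reachability, which the automaton can express.\<close>

lemma (in wf_digraph) on_lobe_iff_reachable:
  "on_lobe G e \<longleftrightarrow> e \<in> arcs G \<and> head G e \<rightarrow>\<^sup>*\<^bsub>G\<^esub> tail G e"
proof
  assume "on_lobe G e"
  then obtain p a where p: "awalk a p a" "e \<in> set p"
    unfolding on_lobe_def minimal_cycle_def cycle_def by blast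
  then obtain xs ys where "p = xs @ e # ys"
    by (meson split_list)
  with p(1) have "awalk a xs (tail G e)" "e \<in> arcs G" "awalk (head G e) ys a"
    by (auto simp: awalk_Cons_iff)
  then show "e \<in> arcs G \<and> head G e \<rightarrow>\<^sup>*\<^bsub>G\<^esub> tail G e"
    using awalk_appendI reachable_awalkI by blast
next
  assume e: "e \<in> arcs G \<and> head G e \<rightarrow>\<^sup>*\<^bsub>G\<^esub> tail G e"
  then obtain p where "apath (head G e) p (tail G e)"
    by (metis reachable_awalk apath_awalk_to_apath)
  then have "cycle (e # p)"
    using e unfolding cycle_def apath_def
    by (intro exI[of _ "tail G e"]) (auto simp: awalk_Cons_iff)
  then show "on_lobe G e"
    unfolding on_lobe_def minimal_cycle_def by (intro exI[of _ "set (e # p)"]) auto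
qed

lemma (in wf_digraph) head_in_tail_image_minimal_cycle:
  assumes C: "minimal_cycle G C" and e: "e \<in> C"
  shows "head G e \<in> tail G ` C"
proof -
  obtain p a where p: "awalk a p a" "C = set p"
    using C unfolding minimal_cycle_def cycle_def by blast
  obtain xs ys where xs: "p = xs @ e # ys"
    using e p(2) by (meson split_list)
  show ?thesis
  proof (cases ys)
    case Nil
    then have "head G e = a"
      using p(1) xs by (simp add: awalk_def)
    moreover have "p \<noteq> []"
      using xs by simp
    then have "tail G (hd p) = a" "hd p \<in> set p"
      using p(1) cas_simp[of p a a] by (auto simp: awalk_def)
    ultimately show ?thesis
      using p(2) by force
  next
    case (Cons f zs)
    then have "head G e = tail G f"
      using p(1) xs by (auto simp: awalk_Cons_iff)
    then show ?thesis
      using p(2) xs Cons by auto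
  qed
qed

text \<open>Rotating the edge list moves the starting point to \<open>u\<close>. Two cycles through
  \<open>u\<close> can then be compared edge by edge from there.\<close>

lemma (in wf_digraph) minimal_cycle_walk_from:
  assumes C: "minimal_cycle G C" and u: "u \<in> tail G ` C"
  obtains p where "awalk u p u" "set p = C"
proof -
  obtain p a where p: "awalk a p a" "C = set p"
    using C unfolding minimal_cycle_def cycle_def by blast
  obtain e where e: "e \<in> set p" "u = tail G e"
    using u p(2) by blast
  obtain xs ys where xs: "p = xs @ e # ys"
    using e(1) by (meson split_list)
  have "awalk a xs u" "awalk u (e # ys) a"
    using p(1) xs e(2) by (auto simp: awalk_Cons_iff)
  then have "awalk u ((e # ys) @ xs) u"
    using awalk_appendI by blast
  moreover have "set ((e # ys) @ xs) = C"
    using p(2) xs by auto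
  ultimately show ?thesis
    using that by blast
qed

text \<open>The tails, in order, are the vertex list without its last entry. For a closed walk this
  is a rotation of the vertex list without its first entry, which is distinct by the definition of a
  cycle.\<close>

lemma (in wf_digraph) inj_on_tail_minimal_cycle:
  assumes "minimal_cycle G C"
  shows "inj_on (tail G) C"
proof -
  obtain p a where p: "awalk a p a" "distinct (tl (awalk_verts a p))" "p \<noteq> []" "C = set p"
    using assms unfolding minimal_cycle_def cycle_def by blast
  define t where "t = tl (awalk_verts a p)"
  have t: "awalk_verts a p = a # t"
    using p(1) unfolding t_def by (metis awhd_of_awalk awalk_verts_non_Nil list.collapse)
  have "t \<noteq> []"
    using p(3) unfolding t_def by (cases p) (auto simp: awalk_verts_conv)
  moreover have "last (awalk_verts a p) = a"
    using p(1) by auto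
  ultimately have "t = butlast t @ [a]"
    using t by (metis append_butlast_last_id last.simps)
  then have "distinct (butlast t @ [a])"
    using p(2) t_def by metis
  then have "distinct (a # butlast t)"
    by auto
  moreover have "map (tail G) p = a # butlast t"
  proof -
    have "map (tail G) p = butlast (awalk_verts a p)"
      using p(3) by (simp add: awalk_verts_conv)
    then show ?thesis
      using t \<open>t \<noteq> []\<close> by simp
  qed
  ultimately show ?thesis
    using p(4) by (metis distinct_map)
qed

text \<open>If cycles through a vertex are unique, two lobe edges with a common tail lie on one
  cycle, where tails are injective. Conversely, following \<open>C\<close> from a vertex shared with
  \<open>C'\<close>, each edge is the only lobe edge at its tail and so belongs to
  \<open>C'\<close>; by symmetry the cycles agree.\<close>

lemma (in wf_digraph) minimal_cycles_unique_iff: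
  "(\<forall>u\<in>verts G. \<forall>C C'. minimal_cycle G C \<and> u \<in> tail G ` C \<and>
      minimal_cycle G C' \<and> u \<in> tail G ` C' \<longrightarrow> C = C') \<longleftrightarrow>
   (\<forall>e e'. on_lobe G e \<and> on_lobe G e' \<and> tail G e = tail G e' \<longrightarrow> e = e')"
  (is "?L \<longleftrightarrow> ?R")
proof
  assume L: ?L
  show ?R
  proof (intro allI impI, elim conjE)
    fix e e' assume lobes: "on_lobe G e" "on_lobe G e'" and eq: "tail G e = tail G e'"
    then obtain C C' where C: "minimal_cycle G C" "e \<in> C" "minimal_cycle G C'" "e' \<in> C'"
      unfolding on_lobe_def by blast
    have "tail G e \<in> verts G"
      using lobes(1) on_lobe_iff_reachable by simp
    then have "C = C'"
      using L C eq by blast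
    then show "e = e'"
      using inj_on_tail_minimal_cycle[OF C(1)] C eq by (auto dest: inj_onD)
  qed
next
  assume R: ?R
  have sub: "C \<subseteq> C'"
    if C: "minimal_cycle G C" "u \<in> tail G ` C" and C': "minimal_cycle G C'" "u \<in> tail G ` C'"
    for u C C'
  proof -
    \<comment> \<open>Generalized to walks inside \<open>C\<close> with arbitrary end, with the
      invariant that the current vertex still lies on \<open>C'\<close>.\<close>
    have walk: "set p \<subseteq> C'" if "awalk u p v" "set p \<subseteq> C" "u \<in> tail G ` C'" for u p v
      using that
    proof (induction p arbitrary: u)
      case (Cons e p)
      obtain e' where e': "e' \<in> C'" "tail G e' = u"
        using Cons.prems by auto
      have "on_lobe G e" "on_lobe G e'"
        using C(1) C'(1) e'(1) Cons.prems(2) unfolding on_lobe_def by auto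
      moreover have "tail G e = tail G e'"
        using Cons.prems(1) e'(2) by (simp add: awalk_Cons_iff)
      ultimately have "e = e'"
        using R by blast
      then have "set p \<subseteq> C'"
        using Cons.prems e'(1) head_in_tail_image_minimal_cycle[OF C'(1)]
        by (intro Cons.IH[of "head G e"]) (auto simp: awalk_Cons_iff)
      then show ?case
        using \<open>e = e'\<close> e'(1) by simp
    qed simp
    obtain p where "awalk u p u" "set p = C"
      using minimal_cycle_walk_from[OF C] .
    then show ?thesis
      using walk C'(2) by blast
  qed
  show ?L
    by (intro ballI allI impI equalityI; elim conjE) (rule sub; assumption)+
qed


section \<open>Values of expansions\<close>

definition int_val :: "nat \<Rightarrow> symbol list \<Rightarrow> rat" where
  "int_val b p = (\<Sum>i<length p. of_nat (digit_val (p ! i)) * of_nat b ^ (length p - 1 - i))"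

text \<open>Horner form of the fractional part: for positive \<open>b\<close>, prepending a symbol
  acts on the value as an increasing affine map.\<close>

primrec frac_val :: "nat \<Rightarrow> symbol list \<Rightarrow> rat" where
  "frac_val b [] = 0"
| "frac_val b (s # w) = (of_nat (digit_val s) + frac_val b w) / of_nat b"

abbreviation digit_words :: "nat \<Rightarrow> symbol list set" where
  "digit_words b \<equiv> lists (Digit ` {..<b})"

lemma frac_val_eq_sum:
  "frac_val b r = (\<Sum>i<length r. of_nat (digit_val (r ! i)) / of_nat b ^ Suc i)"
proof (induction r)
  case (Cons s r)
  have "(\<Sum>i<length (s # r). of_nat (digit_val ((s # r) ! i)) / of_nat b ^ Suc i :: rat) =
      of_nat (digit_val s) / of_nat b
      + (\<Sum>i<length r. of_nat (digit_val (r ! i)) / of_nat b ^ Suc (Suc i))"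
    by (simp only: length_Cons sum.lessThan_Suc_shift) simp
  also have "(\<Sum>i<length r. of_nat (digit_val (r ! i)) / of_nat b ^ Suc (Suc i) :: rat) =
      frac_val b r / of_nat b"
    unfolding Cons.IH sum_divide_distrib by (simp add: mult.commute)
  finally show ?case
    by (simp add: add_divide_distrib)
qed simp

text \<open>A digit plus a tail below 1 is less than \<open>b\<close>, so the bound survives
  division by \<open>b\<close>. Finiteness of the word makes it strict.\<close>

lemma frac_val_bounds:
  assumes "w \<in> digit_words b"
  shows "0 \<le> frac_val b w" and "frac_val b w < 1"
proof -
  have "0 \<le> frac_val b w \<and> frac_val b w < 1"
    using assms
  proof (induction w)
    case (Cons s w)
    then obtain d where d: "s = Digit d" "d < b"
      by auto
    then have "of_nat d + 1 \<le> (of_nat b :: rat)"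
      by (metis Suc_leI add.commute of_nat_Suc of_nat_le_iff)
    then show ?case
      using Cons d by (auto simp: divide_simps)
  qed simp
  then show "0 \<le> frac_val b w" "frac_val b w < 1"
    by auto
qed

lemma frac_val_append_less_iff:
  assumes "0 < b"
  shows "frac_val b (r @ x) < frac_val b (r @ y) \<longleftrightarrow> frac_val b x < frac_val b y"
  using assms by (induction r) (auto simp: divide_less_cancel)

text \<open>The leading digits differ by at least 1, which the tails, both in the interval from 0 to
  below 1, cannot make up for.\<close>

lemma frac_val_Cons_less:
  assumes "d < d'" "0 < b" "x \<in> digit_words b" "y \<in> digit_words b"
  shows "frac_val b (Digit d # x) < frac_val b (Digit d' # y)"
proof -
  have "of_nat d + 1 \<le> (of_nat d' :: rat)"
    using assms(1) by (metis Suc_leI add.commute of_nat_Suc of_nat_le_iff)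
  then show ?thesis
    using frac_val_bounds[OF assms(3)] frac_val_bounds[OF assms(4)] assms(2)
    by (simp add: divide_less_cancel)
qed

lemma lists_Sigma_base_no_radix:
  assumes "w \<in> lists (Sigma_base b)" "Radix \<notin> set w"
  shows "w \<in> digit_words b"
  using assms unfolding Sigma_base_def by (induction w) auto

text \<open>Uniqueness of the radix point excludes a second one on either side, so the displayed
  occurrence separates integer and fractional digits.\<close>

lemma valid_expansion_split:
  assumes "valid_expansion b (p @ Radix # r)"
  shows "p \<in> digit_words b" and "r \<in> digit_words b" and "p \<noteq> [] \<Longrightarrow> hd p \<noteq> Digit 0"
    and "radix_pos (p @ Radix # r) = length p"
    and "expansion_value b (p @ Radix # r) = int_val b p + frac_val b r"
proof -
  let ?w = "p @ Radix # r"
  let ?P = "\<lambda>k. k < length ?w \<and> ?w ! k = Radix"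
  have ex1: "\<exists>!k. ?P k"
    using assms unfolding valid_expansion_def by simp
  have at: "?P (length p)"
    by simp
  have uniq: "k = length p" if "?P k" for k
    using ex1 that at by blast
  have Sig: "?w \<in> lists (Sigma_base b)"
    using assms unfolding valid_expansion_def by blast
  have "Radix \<notin> set p"
  proof
    assume "Radix \<in> set p"
    then obtain i where "i < length p" "p ! i = Radix"
      by (auto simp: in_set_conv_nth)
    moreover from this have "i = length p"
      by (intro uniq) (simp add: nth_append)
    ultimately show False
      by simp
  qed
  then show "p \<in> digit_words b"
    using Sig lists_Sigma_base_no_radix by auto
  have "Radix \<notin> set r"
  proof
    assume "Radix \<in> set r"
    then obtain i where "i < length r" "r ! i = Radix"
      by (auto simp: in_set_conv_nth)
    then have "length p + Suc i = length p"
      by (intro uniq) (simp add: nth_append)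
    then show False
      by simp
  qed
  then show "r \<in> digit_words b"
    using Sig lists_Sigma_base_no_radix by auto
  show "hd p \<noteq> Digit 0" if "p \<noteq> []"
    using assms that unfolding valid_expansion_def by simp
  show rp: "radix_pos ?w = length p"
    unfolding radix_pos_def using at uniq by (rule the_equality)
  have "(\<Sum>i<length p. of_nat (digit_val (?w ! i)) * of_nat b ^ (length p - 1 - i)) = int_val b p"
    unfolding int_val_def by (rule sum.cong) (auto simp: nth_append)
  moreover have "(\<Sum>i\<in>{length p<..<length ?w}.
      of_nat (digit_val (?w ! i)) / of_nat b ^ (i - length p)) = frac_val b r"
    \<comment> \<open>Entry \<open>j\<close> of \<open>r\<close> stands at position
      \<open>length p + Suc j\<close> of the whole word, hence has weight exponent
      \<open>Suc j\<close>.\<close>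
    unfolding frac_val_eq_sum
    by (rule sum.reindex_bij_witness[of _ "\<lambda>j. length p + Suc j" "\<lambda>i. i - Suc (length p)"])
      (auto simp: nth_append Suc_diff_Suc)
  ultimately show "expansion_value b ?w = int_val b p + frac_val b r"
    unfolding expansion_value_def rp by simp
qed

lemma length_le_int_val:
  assumes "1 < b" "p \<in> digit_words b" "p \<noteq> [] \<Longrightarrow> hd p \<noteq> Digit 0"
  shows "of_nat (length p) \<le> int_val b p"
proof (cases p)
  case (Cons s q)
  then obtain d where d: "s = Digit d" "1 \<le> d"
    using assms by (cases s) (auto simp: Suc_le_eq)
  have "length p \<le> 2 ^ length q"
    using Cons by (simp add: Suc_leI)
  also have "\<dots> \<le> b ^ length q"
    using assms(1) by (simp add: power_mono)
  also have "\<dots> \<le> d * b ^ length q"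
    using d by simp
  finally have "(of_nat (length p) :: rat) \<le> of_nat (d * b ^ length q)"
    by (simp only: of_nat_le_iff)
  also have "\<dots> = of_nat (digit_val (p ! 0)) * of_nat b ^ (length p - 1 - 0)"
    using Cons d by simp
  also have "\<dots> \<le> int_val b p"
    unfolding int_val_def by (rule member_le_sum) (auto simp: Cons)
  finally show ?thesis .
qed (simp add: int_val_def)

text \<open>A bound on the integer part bounds the length. This finiteness later lets a pigeonhole
  argument fix the integer part along a descent.\<close>

lemma finite_int_val_le:
  assumes "1 < b"
  shows "finite {p \<in> digit_words b. (p \<noteq> [] \<longrightarrow> hd p \<noteq> Digit 0) \<and> int_val b p \<le> B}"
proof -
  obtain n where n: "B \<le> of_nat n"
    using real_arch_simple by blast
  have "length p \<le> n" if "p \<in> digit_words b" "p \<noteq> [] \<longrightarrow> hd p \<noteq> Digit 0" "int_val b p \<le> B" for p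
    using length_le_int_val[OF assms that(1)] that n by (metis of_nat_le_iff order_trans)
  then have "{p \<in> digit_words b. (p \<noteq> [] \<longrightarrow> hd p \<noteq> Digit 0) \<and> int_val b p \<le> B}
      \<subseteq> {p. set p \<subseteq> Digit ` {..<b} \<and> length p \<le> n}"
    by auto
  moreover have "finite {p. set p \<subseteq> Digit ` {..<b} \<and> length p \<le> n}"
    by (rule finite_lists_length_le) simp
  ultimately show ?thesis
    by (rule finite_subset)
qed


section \<open>Automata reading base \<open>b\<close> expansions\<close>

lemma trans_star_simps [simp]:
  "trans_star M q [] = q"
  "trans_star M q (a # w) = trans_star M (trans M q a) w"
  "trans_star M q (v @ w) = trans_star M (trans_star M q v) w"
  by (simp_all add: trans_star_def)

lemma reachable_from_refl [simp]: "reachable_from M q q"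
  unfolding reachable_from_def by (rule bexI[of _ "[]"]) auto

lemma reachable_from_trans:
  assumes "reachable_from M q1 q2" "reachable_from M q2 q3"
  shows "reachable_from M q1 q3"
proof -
  obtain v w where "v \<in> lists (alphabet M)" "trans_star M q1 v = q2"
      "w \<in> lists (alphabet M)" "trans_star M q2 w = q3"
    using assms unfolding reachable_from_def by blast
  then show ?thesis
    unfolding reachable_from_def by (intro bexI[of _ "v @ w"]) auto
qed

lemma reachable_from_step:
  assumes "a \<in> alphabet M"
  shows "reachable_from M q (trans M q a)"
  unfolding reachable_from_def using assms by (intro bexI[of _ "[a]"]) auto

lemma relevant_if_reachable:
  assumes "reachable_from M q q'" "relevant M q'"
  shows "relevant M q"
  using assms(2) reachable_from_trans[OF assms(1)] unfolding relevant_def by auto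

lemma relevant_iff_word:
  "relevant M q \<longleftrightarrow> (\<exists>z\<in>lists (alphabet M). trans_star M q z \<in> finals M)"
  unfolding relevant_def reachable_from_def by blast

lemma trans_star_in_states:
  assumes "is_dfa M" "q \<in> states M" "w \<in> lists (alphabet M)"
  shows "trans_star M q w \<in> states M"
  using assms(2,3)
proof (induction w arbitrary: q)
  case (Cons a w)
  then show ?case
    using assms(1) unfolding is_dfa_def by simp
qed simp

text \<open>At a relevant state, two digits that both lead back bound each other. The condition
  therefore covers uniqueness of the lobe at \<open>u\<close> as well as the comparison of lobe
  labels with the others.\<close>

definition lobe_maximal :: "nat \<Rightarrow> ('q, symbol) dfa \<Rightarrow> 'q \<Rightarrow> bool" where
  "lobe_maximal b M u \<longleftrightarrow> (\<forall>d<b. \<forall>d'<b.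
     reachable_from M (trans M u (Digit d)) u \<and> relevant M (trans M u (Digit d')) \<longrightarrow> d' \<le> d)"

text \<open>The set \<open>S\<close> is a parameter, so that one automaton can be studied with
  different sets describing its language.\<close>

locale base_automaton =
  fixes b :: nat and M :: "('q, symbol) dfa" and S :: "rat set"
  assumes base: "1 < b" and dfa: "is_dfa M" and alphabet: "alphabet M = Sigma_base b"
    and language: "language M = expansions_of b S"
begin

lemma Digit_in_alphabet: "d < b \<Longrightarrow> Digit d \<in> alphabet M"
  unfolding alphabet Sigma_base_def by simp

section \<open>Accepted words and states behind the radix point\<close>

lemma accepted_expansion:
  assumes "w \<in> lists (alphabet M)" "trans_star M (start M) w \<in> finals M"
  shows "valid_expansion b w" and "expansion_value b w \<in> S"
proof -
  have "w \<in> language M"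
    using assms unfolding language_def by blast
  then show "valid_expansion b w" "expansion_value b w \<in> S"
    unfolding language expansions_of_def by auto
qed

text \<open>All words accepted from \<open>q\<close> can be appended to the same prefix, so the
  resulting values in \<open>S\<close> differ only in the fractional part.\<close>

lemma accepted_continuation:
  assumes w: "p @ Radix # r \<in> lists (alphabet M)" "trans_star M (start M) (p @ Radix # r) = q"
    and z: "z \<in> lists (alphabet M)" "trans_star M q z \<in> finals M"
  shows "valid_expansion b (p @ Radix # (r @ z))" and "z \<in> digit_words b"
    and "int_val b p + frac_val b (r @ z) \<in> S"
proof -
  have acc: "p @ Radix # (r @ z) \<in> lists (alphabet M)"
      "trans_star M (start M) (p @ Radix # (r @ z)) \<in> finals M"
    using w z by auto
  note e = accepted_expansion[OF acc]
  show "valid_expansion b (p @ Radix # (r @ z))"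
    by (fact e(1))
  show "z \<in> digit_words b"
    using valid_expansion_split(2)[OF e(1)] by simp
  show "int_val b p + frac_val b (r @ z) \<in> S"
    using e(2) valid_expansion_split(5)[OF e(1)] by simp
qed

lemma postradix_word:
  assumes "postradix b M q"
  obtains p r where "p @ Radix # r \<in> lists (alphabet M)"
    and "trans_star M (start M) (p @ Radix # r) = q"
proof -
  obtain w i where w: "valid_expansion b w" "radix_pos w < i" "i \<le> length w"
      "q = trans_star M (start M) (take i w)"
    using assms unfolding postradix_def by blast
  have "\<exists>!k. k < length w \<and> w ! k = Radix"
    using w(1) unfolding valid_expansion_def by blast
  from theI'[OF this] have "w ! radix_pos w = Radix"
    unfolding radix_pos_def by blast
  then have "Radix \<in> set (take i w)"
    using w(2,3) by (metis in_set_conv_nth length_take min.absorb2 nth_take)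
  then obtain p r where "take i w = p @ Radix # r"
    by (meson split_list)
  moreover have "take i w \<in> lists (alphabet M)"
    using w(1) unfolding valid_expansion_def alphabet lists_eq_set by (auto dest: in_set_takeD)
  ultimately show ?thesis
    using that w(4) by metis
qed

text \<open>Relevance supplies an accepted continuation, and acceptance makes the completed word the
  valid expansion that \<open>postradix\<close> asks for.\<close>

lemma postradixI:
  assumes w: "p @ Radix # r \<in> lists (alphabet M)" "trans_star M (start M) (p @ Radix # r) = q"
    and "relevant M q"
  shows "postradix b M q"
proof -
  obtain z where z: "z \<in> lists (alphabet M)" "trans_star M q z \<in> finals M"
    using assms(3) unfolding relevant_iff_word by blast
  note v = accepted_continuation(1)[OF w z]
  show ?thesis
    unfolding postradix_def
    using v valid_expansion_split(4)[OF v] w(2)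
    by (intro exI[of _ "p @ Radix # (r @ z)"] exI[of _ "length (p @ Radix # r)"]) auto
qed

lemma postradix_reachable:
  assumes "postradix b M q" "reachable_from M q q'" "relevant M q'"
  shows "postradix b M q'"
proof -
  obtain p r where w: "p @ Radix # r \<in> lists (alphabet M)"
      "trans_star M (start M) (p @ Radix # r) = q"
    using postradix_word[OF assms(1)] .
  obtain v where v: "v \<in> lists (alphabet M)" "trans_star M q v = q'"
    using assms(2) unfolding reachable_from_def by blast
  show ?thesis
    using w v assms(3) by (intro postradixI[of p "r @ v"]) auto
qed

text \<open>The radix point has already been read, and an accepted word contains only one.\<close>

lemma postradix_accepted_digits:
  assumes "postradix b M q" "z \<in> lists (alphabet M)" "trans_star M q z \<in> finals M"
  shows "z \<in> digit_words b"
proof -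
  obtain p r where w: "p @ Radix # r \<in> lists (alphabet M)"
      "trans_star M (start M) (p @ Radix # r) = q"
    using postradix_word[OF assms(1)] .
  show ?thesis
    by (rule accepted_continuation(2)[OF w assms(2,3)])
qed

lemma postradix_label:
  assumes "postradix b M q" "s \<in> alphabet M" "relevant M (trans M q s)"
  obtains d where "d < b" "s = Digit d"
proof -
  obtain z where "z \<in> lists (alphabet M)" "trans_star M (trans M q s) z \<in> finals M"
    using assms(3) unfolding relevant_iff_word by blast
  then have "s # z \<in> digit_words b"
    using assms by (intro postradix_accepted_digits[OF assms(1)]) auto
  then show ?thesis
    using that by auto
qed

text \<open>A pumping argument: a common prefix preserves the order of fractional parts, so one
  decrease caused by \<open>c\<close> repeats with every further copy of \<open>c\<close> and yields
  an infinite descent in \<open>S\<close>.\<close>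

lemma no_descending_loop:
  assumes S: "well_ordered_set S" and q: "postradix b M q"
    and c: "c \<in> lists (alphabet M)" "trans_star M q c = q"
    and v: "v \<in> lists (alphabet M)" "trans_star M q v \<in> finals M"
  shows "\<not> frac_val b (c @ v) < frac_val b v"
proof
  assume less: "frac_val b (c @ v) < frac_val b v"
  obtain p r where w: "p @ Radix # r \<in> lists (alphabet M)"
      "trans_star M (start M) (p @ Radix # r) = q"
    using postradix_word[OF q] .
  define z where "z n = ((@) c ^^ n) v" for n
  have z: "z n \<in> lists (alphabet M)" "trans_star M q (z n) \<in> finals M"
      "frac_val b (z (Suc n)) < frac_val b (z n)" for n
    using c v less base by (induction n) (auto simp: z_def frac_val_append_less_iff)
  define f where "f n = int_val b p + frac_val b (r @ z n)" for n
  have "f n \<in> S" for n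
    unfolding f_def using accepted_continuation(3)[OF w z(1,2)] .
  moreover have "f (Suc n) < f n" for n
    unfolding f_def using z(3) base by (simp add: frac_val_append_less_iff)
  ultimately show False
    using S unfolding well_ordered_set_def by blast
qed

lemma lobe_maximal_if_well_ordered:
  assumes S: "well_ordered_set S" and q: "postradix b M q"
  shows "lobe_maximal b M q"
  unfolding lobe_maximal_def
proof (intro allI impI, elim conjE, rule ccontr)
  fix d d'
  assume d: "d < b" "d' < b" and ret: "reachable_from M (trans M q (Digit d)) q"
    and rel: "relevant M (trans M q (Digit d'))" and "\<not> d' \<le> d"
  obtain y where y: "y \<in> lists (alphabet M)" "trans_star M (trans M q (Digit d)) y = q"
    using ret unfolding reachable_from_def by blast
  obtain z where z: "z \<in> lists (alphabet M)" "trans_star M (trans M q (Digit d')) z \<in> finals M"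
    using rel unfolding relevant_iff_word by blast
  let ?c = "Digit d # y" and ?v = "Digit d' # z"
  have c: "?c \<in> lists (alphabet M)" "trans_star M q ?c = q"
    and v: "?v \<in> lists (alphabet M)" "trans_star M q ?v \<in> finals M"
    using y z d Digit_in_alphabet by auto
  \<comment> \<open>The loop word starts with the smaller digit \<open>d\<close>, so going round
    once before \<open>?v\<close> lowers the value, provided all symbols are digits.\<close>
  have "?c @ ?v \<in> digit_words b"
    using c v by (intro postradix_accepted_digits[OF q]) auto
  then have "frac_val b (?c @ ?v) < frac_val b ?v"
    using \<open>\<not> d' \<le> d\<close> base frac_val_Cons_less[of d d' b "y @ ?v" z] by auto
  then show False
    using no_descending_loop[OF S q c v] by blast
qed

end


section \<open>Saguaros of relevant states\<close>

context base_automaton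
begin

section \<open>The relevant subgraph of a single postradix state\<close>

context
  fixes q :: 'q and G :: "('q, 'q \<times> symbol \<times> 'q) pre_digraph"
  assumes q: "q \<in> states M" "relevant M q" "postradix b M q"
  defines "G \<equiv> relevant_subgraph M q"
begin

lemma verts_relevant_subgraph:
  "u \<in> verts G \<longleftrightarrow> u \<in> states M \<and> relevant M u \<and> reachable_from M q u"
  unfolding G_def relevant_subgraph_def by simp

lemma arcs_relevant_subgraph:
  "(u, s, v) \<in> arcs G \<longleftrightarrow>
    u \<in> verts G \<and> v \<in> verts G \<and> s \<in> alphabet M \<and> trans M u s = v"
  unfolding G_def relevant_subgraph_def transition_graph_def by auto

lemma ends_relevant_subgraph [simp]:
  "tail G (u, s, v) = u" "head G (u, s, v) = v"
  unfolding G_def relevant_subgraph_def transition_graph_def by simp_all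

lemma wf_relevant_subgraph: "wf_digraph G"
  by unfold_locales (auto simp: arcs_relevant_subgraph)

interpretation wf_digraph G
  by (rule wf_relevant_subgraph)

lemma root_in_verts: "q \<in> verts G"
  using q by (simp add: verts_relevant_subgraph)

text \<open>Every vertex satisfies the assumptions made on the root. Conditions on all vertices of
  all these subgraphs thus reduce to one condition per relevant postradix state.\<close>

lemma verts_relevant_postradix:
  assumes "u \<in> verts G"
  shows "u \<in> states M \<and> relevant M u \<and> postradix b M u"
  using assms postradix_reachable[OF q(3)] unfolding verts_relevant_subgraph by blast

lemmas postradix_verts = verts_relevant_postradix[THEN conjunct2, THEN conjunct2]

lemma arc_relevant_subgraphI:
  assumes "u \<in> verts G" "s \<in> alphabet M" "relevant M (trans M u s)"
  shows "(u, s, trans M u s) \<in> arcs G"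
proof -
  have "trans M u s \<in> states M"
    using assms(1,2) dfa unfolding verts_relevant_subgraph is_dfa_def by blast
  moreover have "reachable_from M q (trans M u s)"
    using assms(1) unfolding verts_relevant_subgraph
    by (intro reachable_from_trans[OF _ reachable_from_step[OF assms(2)]]) simp
  ultimately have "trans M u s \<in> verts G"
    using assms(3) by (simp add: verts_relevant_subgraph)
  then show ?thesis
    using assms(1,2) by (simp add: arcs_relevant_subgraph)
qed

text \<open>A run ending in the relevant state \<open>v\<close> never leaves \<open>G\<close>: each
  state on the way reaches \<open>v\<close> and is therefore relevant itself.\<close>

lemma reachable_relevant_subgraph_iff:
  assumes "u \<in> verts G" "v \<in> verts G"
  shows "u \<rightarrow>\<^sup>*\<^bsub>G\<^esub> v \<longleftrightarrow> reachable_from M u v"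
proof
  assume "u \<rightarrow>\<^sup>*\<^bsub>G\<^esub> v"
  then obtain p where "awalk u p v"
    using reachable_awalk by blast
  then show "reachable_from M u v"
  proof (induction p arbitrary: u)
    case (Cons e p)
    obtain s where "e = (u, s, trans M u s)" "s \<in> alphabet M"
      using Cons.prems by (cases e) (auto simp: awalk_Cons_iff arcs_relevant_subgraph)
    then show ?case
      using Cons reachable_from_step reachable_from_trans
      by (metis awalk_Cons_iff ends_relevant_subgraph(2))
  qed (simp add: awalk_Nil_iff)
next
  assume "reachable_from M u v"
  then obtain w where "w \<in> lists (alphabet M)" "trans_star M u w = v"
    unfolding reachable_from_def by blast
  then show "u \<rightarrow>\<^sup>*\<^bsub>G\<^esub> v"
    using assms
  proof (induction w arbitrary: u rule: list.induct)
    case (Cons s w)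
    have w: "w \<in> lists (alphabet M)" "trans_star M (trans M u s) w = v" and s: "s \<in> alphabet M"
      using Cons.prems(1,2) by auto
    have "relevant M v"
      using Cons.prems(4) by (simp add: verts_relevant_subgraph)
    moreover have "reachable_from M (trans M u s) v"
      using w unfolding reachable_from_def by blast
    ultimately have "relevant M (trans M u s)"
      using relevant_if_reachable by metis
    then have arc: "(u, s, trans M u s) \<in> arcs G"
      by (intro arc_relevant_subgraphI Cons.prems(3) s)
    then have "trans M u s \<in> verts G"
      by (simp add: arcs_relevant_subgraph)
    then have "trans M u s \<rightarrow>\<^sup>*\<^bsub>G\<^esub> v"
      by (intro Cons.IH w Cons.prems(4))
    moreover have "u \<rightarrow>\<^bsub>G\<^esub> trans M u s"
      using in_arcs_imp_in_arcs_ends[OF arc] by simp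
    ultimately show ?case
      by (rule adj_reachable_trans[rotated])
  qed simp
qed

lemma on_lobe_relevant_subgraph_iff:
  "on_lobe G (u, s, v) \<longleftrightarrow> (u, s, v) \<in> arcs G \<and> reachable_from M v u"
proof -
  have "v \<rightarrow>\<^sup>*\<^bsub>G\<^esub> u \<longleftrightarrow> reachable_from M v u" if "(u, s, v) \<in> arcs G"
    using that by (intro reachable_relevant_subgraph_iff) (simp_all add: arcs_relevant_subgraph)
  then show ?thesis
    unfolding on_lobe_iff_reachable ends_relevant_subgraph by (rule conj_cong[OF refl])
qed

lemma arc_label_digit:
  assumes "(u, s, v) \<in> arcs G"
  obtains d where "d < b" "s = Digit d"
proof -
  have u: "u \<in> verts G" and s: "s \<in> alphabet M" "relevant M (trans M u s)"
    using assms by (simp_all add: arcs_relevant_subgraph verts_relevant_subgraph)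
  show ?thesis
    by (rule postradix_label[OF postradix_verts[OF u] s]) (rule that)
qed

text \<open>Given a returning digit, another available digit either lies on a lobe too, and equals
  it by uniqueness, or is smaller by the labeling. Conversely, maximality makes lobe digits at a
  vertex coincide, and determinism then identifies the edges.\<close>

lemma saguaro_iff_lobe_maximal:
  "rooted_saguaro G q \<and> properly_labeled_by_transitions b G \<longleftrightarrow> (\<forall>u\<in>verts G. lobe_maximal b M u)"
  (is "?L \<longleftrightarrow> ?R")
proof
  assume L: ?L
  then have lobes_eq: "e = e'" if "on_lobe G e" "on_lobe G e'" "tail G e = tail G e'" for e e'
    using that minimal_cycles_unique_iff unfolding rooted_saguaro_def by blast
  obtain l where l: "\<And>e. e \<in> arcs G \<Longrightarrow> edge_label e = Digit (l e)" "proper_labeling b G l"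
    using L unfolding properly_labeled_by_transitions_def by blast
  show ?R
    unfolding lobe_maximal_def
  proof (intro ballI allI impI, elim conjE)
    fix u d d'
    assume u: "u \<in> verts G" and d: "d < b" "d' < b"
      and ret: "reachable_from M (trans M u (Digit d)) u"
      and rel: "relevant M (trans M u (Digit d'))"
    let ?e = "(u, Digit d, trans M u (Digit d))" and ?e' = "(u, Digit d', trans M u (Digit d'))"
    have "relevant M (trans M u (Digit d))"
      using relevant_if_reachable[OF ret] u by (simp add: verts_relevant_subgraph)
    then have e: "?e \<in> arcs G" and e': "?e' \<in> arcs G"
      using u d rel by (simp_all add: Digit_in_alphabet arc_relevant_subgraphI)
    have lobe: "on_lobe G ?e"
      using e ret by (simp add: on_lobe_relevant_subgraph_iff)
    show "d' \<le> d"
    proof (cases "on_lobe G ?e'")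
      case True
      then show ?thesis
        using lobes_eq[OF lobe True] by simp
    next
      case False
      then have "l ?e' < l ?e"
        using l(2) lobe e e' unfolding proper_labeling_def by simp
      then show ?thesis
        using l(1)[OF e] l(1)[OF e'] by (simp add: edge_label_def)
    qed
  qed
next
  assume R: ?R
  have max: "d' \<le> d" if "on_lobe G (u, Digit d, v)" "(u, Digit d', v') \<in> arcs G" for u v v' d d'
  proof -
    have "u \<in> verts G" "reachable_from M (trans M u (Digit d)) u" "relevant M (trans M u (Digit d'))"
      using that by (auto simp: on_lobe_relevant_subgraph_iff arcs_relevant_subgraph
          verts_relevant_subgraph)
    moreover have "d < b" "d' < b"
      using that by (auto simp: on_lobe_relevant_subgraph_iff elim: arc_label_digit)
    ultimately show ?thesis
      using R unfolding lobe_maximal_def by blast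
  qed
  have "e = e'" if lobes: "on_lobe G e" "on_lobe G e'" "tail G e = tail G e'" for e e'
  proof -
    have "e \<in> arcs G" "e' \<in> arcs G"
      using lobes on_lobe_iff_reachable by simp_all
    then obtain u d v d' v' where e: "e = (u, Digit d, v)" "e' = (u, Digit d', v')"
        "e \<in> arcs G" "e' \<in> arcs G"
      using lobes(3) arc_label_digit by (cases e, cases e') (metis ends_relevant_subgraph(1))
    then have "d = d'"
      using lobes(1,2) max by (metis antisym)
    then show ?thesis
      using e by (auto simp: arcs_relevant_subgraph)
  qed
  moreover have "q \<rightarrow>\<^sup>*\<^bsub>G\<^esub> u" if "u \<in> verts G" for u
    using that root_in_verts reachable_relevant_subgraph_iff[of q u]
    by (simp add: verts_relevant_subgraph)
  ultimately have "rooted_saguaro G q"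
    unfolding rooted_saguaro_def minimal_cycles_unique_iff
    using wf_relevant_subgraph root_in_verts by blast
  moreover have "properly_labeled_by_transitions b G"
    unfolding properly_labeled_by_transitions_def
  proof (intro exI conjI ballI)
    \<comment> \<open>The value 0 that \<open>digit_val\<close> gives to \<open>Radix\<close> is
      harmless, since every arc of \<open>G\<close> carries a digit.\<close>
    let ?l = "\<lambda>e. digit_val (edge_label e)"
    have lab: "\<exists>u d v. e = (u, Digit d, v) \<and> d < b \<and> v = trans M u (Digit d)"
      if "e \<in> arcs G" for e
      using that arc_label_digit by (cases e) (metis arcs_relevant_subgraph)
    show "edge_label e = Digit (?l e)" if "e \<in> arcs G" for e
      using lab[OF that] by (auto simp: edge_label_def)
    show "proper_labeling b G ?l"
      unfolding proper_labeling_def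
    proof (intro conjI ballI impI)
      fix e assume "e \<in> arcs G"
      then show "?l e < b"
        using lab[of e] by (auto simp: edge_label_def)
    next
      fix e e' assume "e \<in> arcs G" "e' \<in> arcs G" "e \<noteq> e' \<and> tail G e = tail G e'"
      then show "?l e \<noteq> ?l e'"
        using lab[of e] lab[of e'] by (auto simp: edge_label_def)
    next
      fix e e'
      assume e: "e \<in> arcs G" "e' \<in> arcs G"
        and lobe: "tail G e = tail G e' \<and> on_lobe G e \<and> \<not> on_lobe G e'"
      obtain u d d' where "e = (u, Digit d, trans M u (Digit d))"
          "e' = (u, Digit d', trans M u (Digit d'))"
        using lab[OF e(1)] lab[OF e(2)] lobe by auto
      moreover from this have "d \<noteq> d'" "d' \<le> d"
        using lobe e max by blast+
      ultimately show "?l e' < ?l e"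
        by (simp add: edge_label_def)
    qed
  qed
  ultimately show ?L
    by blast
qed

end

text \<open>One direction evaluates the vertexwise condition at the root. The other uses that all
  vertices are again relevant and postradix.\<close>

lemma saguaros_iff_lobe_maximal:
  "(\<forall>q\<in>states M. relevant M q \<and> postradix b M q \<longrightarrow>
      rooted_saguaro (relevant_subgraph M q) q \<and>
      properly_labeled_by_transitions b (relevant_subgraph M q)) \<longleftrightarrow>
   (\<forall>q\<in>states M. relevant M q \<and> postradix b M q \<longrightarrow> lobe_maximal b M q)"
proof (intro iffI ballI impI; elim conjE)
  fix q
  assume "\<forall>q\<in>states M. relevant M q \<and> postradix b M q \<longrightarrow>
      rooted_saguaro (relevant_subgraph M q) q \<and>
      properly_labeled_by_transitions b (relevant_subgraph M q)"
    and q: "q \<in> states M" "relevant M q" "postradix b M q"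
  then have "rooted_saguaro (relevant_subgraph M q) q \<and>
      properly_labeled_by_transitions b (relevant_subgraph M q)"
    by simp
  then have "\<forall>u\<in>verts (relevant_subgraph M q). lobe_maximal b M u"
    by (rule iffD1[OF saguaro_iff_lobe_maximal[OF q]])
  then show "lobe_maximal b M q"
    by (rule bspec[OF _ root_in_verts[OF q]])
next
  fix q
  assume R: "\<forall>q\<in>states M. relevant M q \<and> postradix b M q \<longrightarrow> lobe_maximal b M q"
    and q: "q \<in> states M" "relevant M q" "postradix b M q"
  have "lobe_maximal b M u" if "u \<in> verts (relevant_subgraph M q)" for u
    using R verts_relevant_postradix[OF q that] by simp
  then show "rooted_saguaro (relevant_subgraph M q) q \<and>
      properly_labeled_by_transitions b (relevant_subgraph M q)"
    by (intro iffD2[OF saguaro_iff_lobe_maximal[OF q]] ballI)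
qed


section \<open>Descending sequences\<close>

text \<open>This is an infinite descent of values after a fixed prefix has been removed; only
  continuations from \<open>q\<close> are compared.\<close>

definition descending :: "'q \<Rightarrow> (nat \<Rightarrow> symbol list) \<Rightarrow> bool" where
  "descending q f \<longleftrightarrow> (\<forall>n. f n \<in> lists (alphabet M) \<and> trans_star M q (f n) \<in> finals M \<and>
     frac_val b (f (Suc n)) < frac_val b (f n))"

lemma descending_relevant: "descending q f \<Longrightarrow> relevant M q"
  unfolding descending_def relevant_iff_word by blast

text \<open>A larger first digit would force a larger value, so the first digits never increase and
  stabilize at their minimum \<open>d\<close>.\<close>

lemma descending_first_digit:
  assumes q: "postradix b M q" and f: "descending q f"
  obtains d k where "d < b" and "\<And>n. \<exists>e w. f n = Digit e # w \<and> d \<le> e \<and> e < b"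
    and "\<And>n. k \<le> n \<Longrightarrow> \<exists>w. f n = Digit d # w"
proof -
  have fd: "f n \<in> digit_words b" for n
    using f postradix_accepted_digits[OF q] unfolding descending_def by metis
  have less: "frac_val b (f (Suc n)) < frac_val b (f n)" for n
    using f unfolding descending_def by simp
  have "\<exists>e w. f n = Digit e # w \<and> e < b \<and> w \<in> digit_words b" for n
  \<comment> \<open>The empty word has value 0, below which no later term can fall.\<close>
  proof (cases "f n")
    case Nil
    then show ?thesis
      using less[of n] frac_val_bounds(1)[OF fd[of "Suc n"]] by simp
  next
    case (Cons s w)
    then show ?thesis
      using fd[of n] by auto
  qed
  then obtain e w where e: "\<And>n. f n = Digit (e n) # w n" "\<And>n. e n < b"
      "\<And>n. w n \<in> digit_words b"
    by metis
  have "e (Suc n) \<le> e n" for n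
  proof (rule ccontr)
    assume "\<not> e (Suc n) \<le> e n"
    then have "frac_val b (f n) < frac_val b (f (Suc n))"
      unfolding e(1) using base e(3) by (intro frac_val_Cons_less) auto
    then show False
      using less[of n] by simp
  qed
  then have anti: "e n \<le> e m" if "m \<le> n" for m n
    using that lift_Suc_antimono_le by metis
  define d where "d = (LEAST x. x \<in> range e)"
  have "d \<in> range e"
    unfolding d_def by (rule LeastI) (rule rangeI)
  then obtain k where k: "d = e k"
    by blast
  have min: "d \<le> e n" for n
    unfolding d_def by (rule Least_le) (rule rangeI)
  show ?thesis
  proof (rule that)
    show "d < b"
      using k e(2) by simp
    show "\<exists>e' w. f n = Digit e' # w \<and> d \<le> e' \<and> e' < b" for n
      using e(1,2) min by blast
    show "\<exists>w. f n = Digit d # w" if "k \<le> n" for n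
      using anti[OF that] min[of n] k e(1)[of n] by simp
  qed
qed

lemma descending_strip:
  assumes "descending q f" "\<And>n. f n = Digit d # g n"
  shows "descending (trans M q (Digit d)) g"
  using assms base unfolding descending_def by (auto simp: divide_less_cancel)

text \<open>Among the states with a descending sequence we pick one that reaches as few others of them
  as possible. From there on, the first digit that occurs infinitely often returns, so it labels
  a lobe and no larger first digit is available; hence all words of a descending sequence share
  their first digit, and stripping it gives a descending sequence with shorter words.\<close>

lemma no_descending:
  assumes max: "\<And>q. q \<in> states M \<Longrightarrow> relevant M q \<Longrightarrow> postradix b M q \<Longrightarrow> lobe_maximal b M q"
    and q0: "q0 \<in> states M" "postradix b M q0"
  shows "\<not> descending q0 f"
proof
  assume f: "descending q0 f"
  define B where "B = {q \<in> states M. postradix b M q \<and> (\<exists>f. descending q f)}"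
  define R where "R q = {v \<in> B. reachable_from M q v}" for q
  have "q0 \<in> B"
    using q0 f unfolding B_def by blast
  then obtain q where q: "q \<in> B" "\<And>v. v \<in> B \<Longrightarrow> card (R q) \<le> card (R v)"
    using ex_has_least_nat[of "\<lambda>q. q \<in> B" q0 "\<lambda>q. card (R q)"] by blast
  have fin: "finite (R v)" for v
  proof (rule finite_subset)
    show "R v \<subseteq> states M"
      unfolding R_def B_def by blast
    show "finite (states M)"
      using dfa unfolding is_dfa_def by simp
  qed
  \<comment> \<open>Minimality of \<open>card (R q)\<close> forces \<open>R v = R q\<close> for each
    \<open>v\<close> in \<open>R q\<close>, so the states of \<open>R q\<close> all reach one
    another.\<close>
  have returns: "reachable_from M v u" if v: "v \<in> R q" and u: "u \<in> R q" for u v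
  proof -
    have "R v \<subseteq> R q"
    proof
      fix x assume "x \<in> R v"
      then show "x \<in> R q"
        using v reachable_from_trans[of M q v x] by (simp add: R_def)
    qed
    moreover have "card (R q) \<le> card (R v)"
      using v q(2)[of v] by (simp add: R_def)
    ultimately have "R v = R q"
      using card_seteq[OF fin] by metis
    then show ?thesis
      using u by (auto simp: R_def)
  qed
  have "\<not> descending v f" if "v \<in> R q" for v f
    using that
  \<comment> \<open>Only the first word is measured; the state may vary within
    \<open>R q\<close>.\<close>
  proof (induction "length (f 0)" arbitrary: v f rule: less_induct)
    case less
    have v: "v \<in> states M" "postradix b M v" "reachable_from M q v"
      using less.prems by (simp_all add: R_def B_def)
    show ?case
    proof
      assume f: "descending v f"
      obtain d k where d: "d < b" "\<And>n. \<exists>e w. f n = Digit e # w \<and> d \<le> e \<and> e < b"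
          "\<And>n. k \<le> n \<Longrightarrow> \<exists>w. f n = Digit d # w"
        by (rule descending_first_digit[OF v(2) f]) (rule that)
      let ?v = "trans M v (Digit d)"
      have step: "reachable_from M v ?v"
        using d(1) by (intro reachable_from_step Digit_in_alphabet)
      have "\<exists>g. \<forall>n. f (k + n) = Digit d # g n"
        using d(3) by (intro choice) simp
      then obtain g where g: "\<And>n. f (k + n) = Digit d # g n"
        by blast
      \<comment> \<open>The tail of the sequence serves only to show that \<open>?v\<close> again
        lies in \<open>R q\<close>, whence \<open>d\<close> leads back to \<open>v\<close>.\<close>
      have "descending v (\<lambda>n. f (k + n))"
        using f unfolding descending_def by simp
      then have g': "descending ?v g"
        using g by (rule descending_strip)
      have "postradix b M ?v"
        using v(2) step descending_relevant[OF g'] by (rule postradix_reachable)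
      moreover have "?v \<in> states M"
        using dfa v(1) d(1) Digit_in_alphabet unfolding is_dfa_def by simp
      ultimately have v': "?v \<in> R q"
        using g' reachable_from_trans[OF v(3) step] by (auto simp: R_def B_def)
      have ret: "reachable_from M ?v v"
        using v' less.prems by (rule returns)
      \<comment> \<open>This must hold from index 0 on and not just from \<open>k\<close>: the
        induction needs \<open>h 0\<close> to be \<open>f 0\<close> without its first
        symbol.\<close>
      have "\<exists>w. f n = Digit d # w" for n
      proof -
        obtain e w where e: "f n = Digit e # w" "d \<le> e" "e < b"
          using d(2)[of n] by blast
        have "w \<in> lists (alphabet M)" "trans_star M (trans M v (Digit e)) w \<in> finals M"
          using f[unfolded descending_def, THEN spec, of n] e(1) by auto
        then have "relevant M (trans M v (Digit e))"
          unfolding relevant_iff_word by blast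
        then have "e \<le> d"
          using max[OF v(1) descending_relevant[OF f] v(2)] d(1) e(3) ret
          unfolding lobe_maximal_def by simp
        then show ?thesis
          using e by simp
      qed
      then obtain h where h: "\<And>n. f n = Digit d # h n"
        by metis
      have "\<not> descending ?v h"
        using less.hyps[of h ?v] h[of 0] v' by simp
      then show False
        using descending_strip[OF f h] by blast
    qed
  qed
  moreover have "q \<in> R q"
    using q(1) by (simp add: R_def)
  ultimately show False
    using q(1) by (auto simp: B_def)
qed

text \<open>Along a descent the integer parts stay below \<open>f 0\<close>, so one of them occurs
  infinitely often. On that subsequence the fractional parts descend from the state after the radix
  point, contradicting \<open>no_descending\<close>.\<close>

lemma well_ordered_if_lobe_maximal:
  assumes max: "\<And>q. q \<in> states M \<Longrightarrow> relevant M q \<Longrightarrow> postradix b M q \<Longrightarrow> lobe_maximal b M q"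
  shows "well_ordered_set (expansion_value b ` language M)"
  unfolding well_ordered_set_def
proof (rule notI, elim exE conjE)
  fix f :: "nat \<Rightarrow> rat"
  assume f: "\<forall>n. f n \<in> expansion_value b ` language M" and dec: "\<forall>n. f (Suc n) < f n"
  have anti: "f n < f m" if "m < n" for m n
    using lift_Suc_mono_less[of "\<lambda>n. - f n" m n] dec that by simp
  have "\<exists>p r. p @ Radix # r \<in> language M \<and> expansion_value b (p @ Radix # r) = f n" for n
  proof -
    obtain w where w: "w \<in> language M" "f n = expansion_value b w"
      using f by blast
    then have "valid_expansion b w"
      unfolding language expansions_of_def by simp
    then have "Radix \<in> set w"
      unfolding valid_expansion_def by (metis nth_mem)
    then obtain p r where "w = p @ Radix # r"
      by (meson split_list)
    then show ?thesis
      using w by auto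
  qed
  then obtain p r where pr: "\<And>n. p n @ Radix # r n \<in> language M"
      "\<And>n. expansion_value b (p n @ Radix # r n) = f n"
    by metis
  have valid: "valid_expansion b (p n @ Radix # r n)" for n
    using pr(1) unfolding language expansions_of_def by simp
  have val: "f n = int_val b (p n) + frac_val b (r n)" for n
    using valid_expansion_split(5)[OF valid] pr(2) by simp
  have "int_val b (p n) \<le> f 0" for n
  proof -
    have "int_val b (p n) \<le> f n"
      using val[of n] frac_val_bounds(1)[OF valid_expansion_split(2)[OF valid[of n]]] by simp
    also have "f n \<le> f 0"
      using anti[of 0 n] by (cases n) auto
    finally show ?thesis .
  qed
  then have "range p \<subseteq> {p \<in> digit_words b. (p \<noteq> [] \<longrightarrow> hd p \<noteq> Digit 0) \<and> int_val b p \<le> f 0}"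
    using valid_expansion_split(1,3)[OF valid] by blast
  then have "finite (range p)"
    using finite_int_val_le[OF base] by (rule finite_subset)
  then obtain P where "infinite {n. p n = P}"
    using pigeonhole_infinite[of UNIV p] by auto
  define s where "s = enumerate {n. p n = P}"
  have s: "p (s n) = P" "s n < s (Suc n)" for n
    using enumerate_in_set[OF \<open>infinite _\<close>, of n] enumerate_step[OF \<open>infinite _\<close>, of n]
    unfolding s_def by auto
  define q where "q = trans_star M (start M) (P @ [Radix])"
  have acc: "P @ Radix # r (s n) \<in> lists (alphabet M)"
      "trans_star M (start M) (P @ Radix # r (s n)) \<in> finals M" for n
  proof -
    have "P @ Radix # r (s n) \<in> language M"
      using pr(1)[of "s n"] s(1)[of n] by simp
    then show "P @ Radix # r (s n) \<in> lists (alphabet M)"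
        "trans_star M (start M) (P @ Radix # r (s n)) \<in> finals M"
      unfolding language_def by blast+
  qed
  have q: "descending q (\<lambda>n. r (s n))"
    unfolding descending_def
  proof (intro allI conjI)
    fix n
    show "r (s n) \<in> lists (alphabet M)"
      using acc(1)[of n] by simp
    show "trans_star M q (r (s n)) \<in> finals M"
      using acc(2)[of n] by (simp add: q_def)
    show "frac_val b (r (s (Suc n))) < frac_val b (r (s n))"
      using anti[OF s(2)[of n]] val[of "s n"] val[of "s (Suc n)"] s(1) by simp
  qed
  have P: "P @ [Radix] \<in> lists (alphabet M)"
    using acc(1)[of 0] by simp
  have "start M \<in> states M"
    using dfa unfolding is_dfa_def by simp
  then have "q \<in> states M"
    unfolding q_def using trans_star_in_states[OF dfa _ P] by simp
  moreover have "postradix b M q"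
    \<comment> \<open>Here the part read after the radix point is empty; the descent itself provides
      relevance.\<close>
    by (rule postradixI[OF P q_def[symmetric] descending_relevant[OF q]])
  ultimately show False
    using no_descending[OF max] q by blast
qed

text \<open>Membership in \<open>expansions_of b S\<close> depends on a valid expansion only through
  its value, so the set of accepted values describes the same language.\<close>

lemma language_eq_expansions_of_values:
  "language M = expansions_of b (expansion_value b ` language M)"
  unfolding language expansions_of_def by auto

end


theorem theorem7p1p6:
  fixes b :: nat and M :: "('q, symbol) dfa"
  assumes "b > 1"
    and "is_dfa M"
    and "alphabet M = Sigma_base b"
    and "minimal_dfa M"
    and "well_formed b M"
  shows "well_ordered b M \<longleftrightarrow>
    (\<forall>q\<in>states M. relevant M q \<and> postradix b M q \<longrightarrow>
       rooted_saguaro (relevant_subgraph M q) q \<and>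
       properly_labeled_by_transitions b (relevant_subgraph M q))"
proof -
  obtain S where S: "S \<subseteq> S_base b" "language M = expansions_of b S"
    using assms(5) unfolding well_formed_def by blast
  interpret base_automaton b M S
    using assms S by unfold_locales
  have "well_ordered b M \<longleftrightarrow>
    (\<forall>q\<in>states M. relevant M q \<and> postradix b M q \<longrightarrow> lobe_maximal b M q)"
  proof
    assume "well_ordered b M"
    then obtain T where T: "well_ordered_set T" "language M = expansions_of b T"
      unfolding well_ordered_def by blast
    \<comment> \<open>The pumped values must lie in the well-ordered set, so the automaton is viewed
      with \<open>T\<close> in place of \<open>S\<close>; \<open>lobe_maximal\<close> mentions
      neither.\<close>
    interpret T: base_automaton b M T
      using assms T by unfold_locales
    show "\<forall>q\<in>states M. relevant M q \<and> postradix b M q \<longrightarrow> lobe_maximal b M q"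
      using T.lobe_maximal_if_well_ordered[OF T(1)] by blast
  next
    assume "\<forall>q\<in>states M. relevant M q \<and> postradix b M q \<longrightarrow> lobe_maximal b M q"
    then have "well_ordered_set (expansion_value b ` language M)"
      by (intro well_ordered_if_lobe_maximal) blast
    moreover have "expansion_value b ` language M \<subseteq> S_base b"
      using S unfolding expansions_of_def by blast
    ultimately show "well_ordered b M"
      unfolding well_ordered_def using language_eq_expansions_of_values by blast
  qed
  then show ?thesis
    unfolding saguaros_iff_lobe_maximal .
qed

end
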